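(* Let $R$ be a commutative ring with unity and let $\Gamma$ be a commutative monoid of finite type. Then: (1) For every $R$-module $M$, $\mathcal F(\Gamma,M)$, with pointwise addition and the product $(\alpha\cdot f)(n)=\sum_{ab=n}\alpha(a)f(b)$ for $\alpha\in\mathcal F(\Gamma,R)$, $f\in\mathcal F(\Gamma,M)$, $n\in\Gamma$, has a structure of $\mathcal F(\Gamma,R)$-module. (2) $\mathcal F(\Gamma,-)$ is an exact covariant functor from the category of $R$-modules to the category of $R$-modules.
   Context: A monoid $(\Gamma,\cdot,1)$ is of finite type if for each $n\in\Gamma$ the set $\{(a,b)\in\Gamma\times\Gamma : n=ab\}$ is finite. $\mathcal F(\Gamma,R)$ is the set of all functions $\alpha:\Gamma\to R$, a commutative ring with unity under $(\alpha+\beta)(n)=\alpha(n)+\beta(n)$ and $(\alpha\cdot\beta)(n)=\sum_{ab=n}\alpha(a)\beta(b)$; its unity is $e$ with $e(1)=1$ and $e(n)=0$ for $n\ne 1$. The map $i:R\to\mathcal F(\Gamma,R)$, $i(r)(1)=r$, $i(r)(n)=0$ for $n\neq 1$, is an injective ring homomorphism, making $\mathcal F(\Gamma,R)$ an $R$-algebra. For an $R$-module $M$, $\mathcal F(\Gamma,M)$ is the set of all functions $f:\Gamma\to M$, with pointwise addition $(f+g)(n)=f(n)+g(n)$; its $R$-module structure is the pointwise one, $(rf)(n)=r f(n)$ (equivalently, through $i$). On a morphism of $R$-modules $\varphi:M\to N$, the functor is given by $\mathcal F(\Gamma,\varphi)(f)=\varphi\circ f$. *)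

theory Defs
  imports "HOL-Algebra.Module" "HOL-Algebra.AbelCoset"
begin

definition factorizations :: "('g, 'h) monoid_scheme \<Rightarrow> 'g \<Rightarrow> ('g \<times> 'g) set" where
  "factorizations \<Gamma> n = {(a, b). a \<in> carrier \<Gamma> \<and> b \<in> carrier \<Gamma> \<and> n = a \<otimes>\<^bsub>\<Gamma>\<^esub> b}"

definition finite_type :: "('g, 'h) monoid_scheme \<Rightarrow> bool" where
  "finite_type \<Gamma> \<longleftrightarrow> (\<forall>n \<in> carrier \<Gamma>. finite (factorizations \<Gamma> n))"

text \<open>
  Functions out of a carrier set are represented by extensional functions (they take the
  value \<^term>\<open>undefined\<close> off the carrier), so that equality of functions in HOL is equality of
  functions on the carrier.
\<close>

definition conv_ring ::
    "('g, 'h) monoid_scheme \<Rightarrow> ('r, 'q) ring_scheme \<Rightarrow> ('g \<Rightarrow> 'r) ring" where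
  "conv_ring \<Gamma> R =
     \<lparr> carrier = carrier \<Gamma> \<rightarrow>\<^sub>E carrier R,
       mult = (\<lambda>\<alpha> \<beta>. \<lambda>n \<in> carrier \<Gamma>.
                 finsum R (\<lambda>(a, b). \<alpha> a \<otimes>\<^bsub>R\<^esub> \<beta> b) (factorizations \<Gamma> n)),
       one = (\<lambda>n \<in> carrier \<Gamma>. if n = \<one>\<^bsub>\<Gamma>\<^esub> then \<one>\<^bsub>R\<^esub> else \<zero>\<^bsub>R\<^esub>),
       zero = (\<lambda>n \<in> carrier \<Gamma>. \<zero>\<^bsub>R\<^esub>),
       add = (\<lambda>\<alpha> \<beta>. \<lambda>n \<in> carrier \<Gamma>. \<alpha> n \<oplus>\<^bsub>R\<^esub> \<beta> n) \<rparr>"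

text \<open>
  A module is a record extending that of rings; its fields \<^term>\<open>mult\<close> and \<^term>\<open>one\<close> carry no
  meaning (the locale \<^locale>\<open>module\<close> does not constrain them) and are left undefined.
  The two records below have the same underlying additive group. The first is
  \<open>\<F>(\<Gamma>, M)\<close> as a module over \<open>\<F>(\<Gamma>, R)\<close>, the second is \<open>\<F>(\<Gamma>, M)\<close> as a module over \<open>R\<close>.
\<close>

definition conv_module ::
    "('g, 'h) monoid_scheme \<Rightarrow> ('r, 'm, 'x) module_scheme \<Rightarrow> ('g \<Rightarrow> 'r, 'g \<Rightarrow> 'm) module" where
  "conv_module \<Gamma> M =
     \<lparr> carrier = carrier \<Gamma> \<rightarrow>\<^sub>E carrier M,
       mult = undefined,
       one = undefined,
       zero = (\<lambda>n \<in> carrier \<Gamma>. \<zero>\<^bsub>M\<^esub>),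
       add = (\<lambda>f g. \<lambda>n \<in> carrier \<Gamma>. f n \<oplus>\<^bsub>M\<^esub> g n),
       smult = (\<lambda>\<alpha> f. \<lambda>n \<in> carrier \<Gamma>.
                  finsum M (\<lambda>(a, b). \<alpha> a \<odot>\<^bsub>M\<^esub> f b) (factorizations \<Gamma> n)) \<rparr>"

definition fun_module ::
    "('g, 'h) monoid_scheme \<Rightarrow> ('r, 'm, 'x) module_scheme \<Rightarrow> ('r, 'g \<Rightarrow> 'm) module" where
  "fun_module \<Gamma> M =
     \<lparr> carrier = carrier \<Gamma> \<rightarrow>\<^sub>E carrier M,
       mult = undefined,
       one = undefined,
       zero = (\<lambda>n \<in> carrier \<Gamma>. \<zero>\<^bsub>M\<^esub>),
       add = (\<lambda>f g. \<lambda>n \<in> carrier \<Gamma>. f n \<oplus>\<^bsub>M\<^esub> g n),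
       smult = (\<lambda>r f. \<lambda>n \<in> carrier \<Gamma>. r \<odot>\<^bsub>M\<^esub> f n) \<rparr>"

text \<open>
  The category of \<open>R\<close>-modules: objects are the \<open>M\<close> with \<^term>\<open>module R M\<close>, morphisms are the
  extensional \<open>R\<close>-linear maps, the identity of \<open>M\<close> is \<^term>\<open>\<lambda>x \<in> carrier M. x\<close>, and the composite
  of \<open>\<phi>\<close> on \<open>M\<close> followed by \<open>\<psi>\<close> is \<^term>\<open>compose (carrier M) \<psi> \<phi>\<close>.
\<close>

definition mod_hom ::
    "('r, 'q) ring_scheme \<Rightarrow> ('r, 'm, 'x) module_scheme \<Rightarrow> ('r, 'n, 'y) module_scheme
      \<Rightarrow> ('m \<Rightarrow> 'n) set" where
  "mod_hom R M N =
     {\<phi> \<in> carrier M \<rightarrow>\<^sub>E carrier N.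
        (\<forall>x \<in> carrier M. \<forall>y \<in> carrier M. \<phi> (x \<oplus>\<^bsub>M\<^esub> y) = \<phi> x \<oplus>\<^bsub>N\<^esub> \<phi> y) \<and>
        (\<forall>r \<in> carrier R. \<forall>x \<in> carrier M. \<phi> (r \<odot>\<^bsub>M\<^esub> x) = r \<odot>\<^bsub>N\<^esub> \<phi> x)}"

definition fun_module_map ::
    "('g, 'h) monoid_scheme \<Rightarrow> ('r, 'm, 'x) module_scheme \<Rightarrow> ('m \<Rightarrow> 'n)
      \<Rightarrow> ('g \<Rightarrow> 'm) \<Rightarrow> ('g \<Rightarrow> 'n)" where
  "fun_module_map \<Gamma> M \<phi> = (\<lambda>f \<in> carrier (fun_module \<Gamma> M). compose (carrier \<Gamma>) \<phi> f)"

definition exact_at ::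
    "('r, 'm, 'x) module_scheme \<Rightarrow> ('m \<Rightarrow> 'n) \<Rightarrow> ('r, 'n, 'y) module_scheme \<Rightarrow> ('n \<Rightarrow> 'p)
      \<Rightarrow> ('r, 'p, 'z) module_scheme \<Rightarrow> bool" where
  "exact_at M \<phi> N \<psi> P \<longleftrightarrow> \<phi> ` carrier M = a_kernel N P \<psi>"

text \<open>Exactness of \<open>0 \<rightarrow> M \<rightarrow> N \<rightarrow> P \<rightarrow> 0\<close>.\<close>

definition short_exact ::
    "('r, 'm, 'x) module_scheme \<Rightarrow> ('m \<Rightarrow> 'n) \<Rightarrow> ('r, 'n, 'y) module_scheme \<Rightarrow> ('n \<Rightarrow> 'p)
      \<Rightarrow> ('r, 'p, 'z) module_scheme \<Rightarrow> bool" where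
  "short_exact M \<phi> N \<psi> P \<longleftrightarrow>
     inj_on \<phi> (carrier M) \<and> exact_at M \<phi> N \<psi> P \<and> \<psi> ` carrier N = carrier P"

end

theory Submission
  imports Defs
begin

text \<open>
  The module axioms for the convolution action are checked value by value, as identities
  between finite sums over factorizations in \<open>\<Gamma>\<close>. Distributivity is termwise. For the unit, only
  the factorization \<open>n = 1 n\<close> contributes to \<open>(e f)(n)\<close>. For \<open>(\<alpha> \<beta>) f = \<alpha> (\<beta> f)\<close>, both sides
  expand to the sum of \<open>\<alpha>(a) \<beta>(b) f(c)\<close> over all triples with \<open>n = a b c\<close>; this exchange of
  summations is \<open>finsum_factorizations_assoc\<close>. The convolution ring needs no separate
  computation apart from commutativity: its product is the action of \<open>\<F>(\<Gamma>, R)\<close> on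
  \<open>\<F>(\<Gamma>, M)\<close> in the case where \<open>M\<close> is \<open>R\<close> itself.

  The functor \<open>\<F>(\<Gamma>, -)\<close> to \<open>R\<close>-modules is a direct power indexed by \<open>\<Gamma>\<close>, so everything about it
  is pointwise. Its value on \<open>\<phi>\<close> has as image all functions into the image of \<open>\<phi>\<close>
  (\<open>fun_module_map_image\<close>, which chooses preimages pointwise) and as kernel all functions into the
  kernel of \<open>\<phi>\<close> (\<open>a_kernel_fun_module_map\<close>). Equality of image and kernel is therefore
  inherited, and so are injectivity and surjectivity.
\<close>

section \<open>Sums over factorizations\<close>

lemma (in comm_monoid) finprod_Sigma:
  assumes "finite A" and "\<And>x. x \<in> A \<Longrightarrow> finite (B x)"
    and "\<And>x y. x \<in> A \<Longrightarrow> y \<in> B x \<Longrightarrow> g x y \<in> carrier G"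
  shows "finprod G (\<lambda>x. finprod G (g x) (B x)) A = finprod G (\<lambda>(x, y). g x y) (Sigma A B)"
proof -
  have "finprod G (\<lambda>(x, y). g x y) (Sigma A B)
      = finprod G (\<lambda>(x, y). g x y) (\<Union>x\<in>A. Pair x ` B x)"
    by (rule arg_cong[where f = "finprod G _"]) auto
  also have "\<dots> = finprod G (\<lambda>x. finprod G (\<lambda>(x, y). g x y) (Pair x ` B x)) A"
    using assms by (intro finprod_UN_disjoint) (auto simp: pairwise_def disjnt_def)
  also have "\<dots> = finprod G (\<lambda>x. finprod G (g x) (B x)) A"
  proof (rule finprod_cong')
    show "finprod G (\<lambda>(x, y). g x y) (Pair x ` B x) = finprod G (g x) (B x)" if "x \<in> A" for x
      using assms(3)[OF that] by (subst finprod_reindex) (auto simp: inj_on_def)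
  qed (use assms in \<open>auto intro!: finprod_closed\<close>)
  finally show ?thesis ..
qed

text \<open>A commutative monoid in which every element has finitely many factorizations into a pair.\<close>

locale finite_type_comm_monoid = comm_monoid \<Gamma> for \<Gamma> (structure) +
  assumes finite_type: "finite_type \<Gamma>"
begin

lemma finite_factorizations: "n \<in> carrier \<Gamma> \<Longrightarrow> finite (factorizations \<Gamma> n)"
  using finite_type by (simp add: finite_type_def)

lemma factorizations_closed:
  assumes "(a, b) \<in> factorizations \<Gamma> n"
  shows "a \<in> carrier \<Gamma>" and "b \<in> carrier \<Gamma>"
  using assms by (auto simp: factorizations_def)

text \<open>
  Both sides are the sum of \<open>g a b c\<close> over all triples with \<open>n = a b c\<close>, bracketed as
  \<open>(a b) c\<close> on the left and as \<open>a (b c)\<close> on the right. This is the only point at which the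
  associativity of \<open>\<Gamma>\<close> is used.
\<close>

lemma finsum_factorizations_assoc:
  fixes M (structure)
  assumes "abelian_monoid M" and n: "n \<in> carrier \<Gamma>"
    and g: "\<And>a b c. \<lbrakk>a \<in> carrier \<Gamma>; b \<in> carrier \<Gamma>; c \<in> carrier \<Gamma>\<rbrakk> \<Longrightarrow> g a b c \<in> carrier M"
  shows "finsum M (\<lambda>(d, c). finsum M (\<lambda>(a, b). g a b c) (factorizations \<Gamma> d)) (factorizations \<Gamma> n)
       = finsum M (\<lambda>(a, d). finsum M (\<lambda>(b, c). g a b c) (factorizations \<Gamma> d)) (factorizations \<Gamma> n)"
proof -
  interpret M: abelian_monoid M by fact
  let ?F = "factorizations \<Gamma>"
  let ?L = "Sigma (?F n) (\<lambda>(d, c). ?F d)" and ?R = "Sigma (?F n) (\<lambda>(a, d). ?F d)"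
  let ?h = "\<lambda>((d, c), (a, b)). ((a, b \<otimes>\<^bsub>\<Gamma>\<^esub> c), (b, c))"
  let ?k = "\<lambda>((a, d), (b, c)). ((a \<otimes>\<^bsub>\<Gamma>\<^esub> b, c), (a, b))"
  \<comment> \<open>\<open>?h\<close> rebrackets \<open>(a b) c\<close> as \<open>a (b c)\<close>, \<open>?k\<close> is its inverse; the first component of an index
    is the outer factorization of \<open>n\<close>, the second the factorization of its composite part.\<close>
  let ?G = "\<lambda>((a, d), (b, c)). g a b c"
  have h: "?R = ?h ` ?L"
  proof (intro equalityI subsetI)
    fix t assume "t \<in> ?R"
    then have "t = ?h (?k t)" and "?k t \<in> ?L"
      by (auto simp: factorizations_def m_assoc)
    then show "t \<in> ?h ` ?L" by (rule image_eqI)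
  qed (auto simp: factorizations_def m_assoc)
  have inj: "inj_on ?h ?L"
    by (auto simp: inj_on_def factorizations_def)
  have "finsum M (\<lambda>(d, c). finsum M (\<lambda>(a, b). g a b c) (?F d)) (?F n)
      = finsum M (\<lambda>x. finsum M (\<lambda>(a, b). g a b (snd x)) (?F (fst x))) (?F n)"
    by (simp add: case_prod_unfold)
  also have "\<dots> = finsum M (\<lambda>(x, y). case y of (a, b) \<Rightarrow> g a b (snd x)) (Sigma (?F n) (\<lambda>x. ?F (fst x)))"
    using n by (intro M.add.finprod_Sigma)
      (auto intro!: finite_factorizations g intro: factorizations_closed)
  also have "\<dots> = finsum M (\<lambda>t. ?G (?h t)) ?L"
    by (simp add: case_prod_unfold)
  also have "\<dots> = finsum M ?G (?h ` ?L)"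
    by (rule M.finsum_reindex[symmetric, OF _ inj]) (auto simp: factorizations_def g)
  also have "?h ` ?L = ?R" by (rule h[symmetric])
  also have "finsum M ?G ?R
      = finsum M (\<lambda>(x, y). case y of (b, c) \<Rightarrow> g (fst x) b c) (Sigma (?F n) (\<lambda>x. ?F (snd x)))"
    by (simp add: case_prod_unfold)
  also have "\<dots> = finsum M (\<lambda>x. finsum M (\<lambda>(b, c). g (fst x) b c) (?F (snd x))) (?F n)"
    using n by (intro M.add.finprod_Sigma[symmetric])
      (auto intro!: finite_factorizations g intro: factorizations_closed)
  also have "\<dots> = finsum M (\<lambda>(a, d). finsum M (\<lambda>(b, c). g a b c) (?F d)) (?F n)"
    by (simp add: case_prod_unfold)
  finally show ?thesis .
qed

lemma finsum_factorizations_commute: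
  fixes M (structure)
  assumes "abelian_monoid M"
    and g: "\<And>a b. \<lbrakk>a \<in> carrier \<Gamma>; b \<in> carrier \<Gamma>\<rbrakk> \<Longrightarrow> g a b \<in> carrier M"
  shows "finsum M (\<lambda>(a, b). g a b) (factorizations \<Gamma> n)
       = finsum M (\<lambda>(a, b). g b a) (factorizations \<Gamma> n)"
proof -
  interpret M: abelian_monoid M by fact
  have "prod.swap ` factorizations \<Gamma> n = factorizations \<Gamma> n"
    by (force simp: factorizations_def m_comm)
  then have "finsum M (\<lambda>(a, b). g a b) (factorizations \<Gamma> n)
      = finsum M (\<lambda>(a, b). g a b) (prod.swap ` factorizations \<Gamma> n)" by simp
  also have "\<dots> = finsum M (\<lambda>(a, b). g b a) (factorizations \<Gamma> n)"
    by (subst M.finsum_reindex) (auto simp: factorizations_def g case_prod_unfold)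
  finally show ?thesis .
qed

end

section \<open>The convolution module\<close>

lemma (in module) finsum_smult_rdistr:
  assumes "finite A" and "x \<in> carrier M" and "f \<in> A \<rightarrow> carrier R"
  shows "finsum R f A \<odot>\<^bsub>M\<^esub> x = (\<Oplus>\<^bsub>M\<^esub> i \<in> A. f i \<odot>\<^bsub>M\<^esub> x)"
  using assms by (induction A rule: finite_induct) (auto simp: Pi_def smult_l_distr)

text \<open>The non-dependent form of membership, which the simplifier can apply by matching.\<close>

lemma PiE_const_mem: "f \<in> I \<rightarrow>\<^sub>E A \<Longrightarrow> i \<in> I \<Longrightarrow> f i \<in> A"
  by (rule PiE_mem)

text \<open>
  The functions from \<open>I\<close> to an abelian group form an abelian group under pointwise addition.
  The fields of \<open>F\<close> other than \<^term>\<open>carrier\<close>, \<^term>\<open>zero\<close> and \<^term>\<open>add\<close> are arbitrary, so that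
  the statement applies to the convolution ring and to both module structures.
\<close>

lemma abelian_group_PiE:
  fixes M (structure) and F :: "('i \<Rightarrow> 'a, 'z) ring_scheme"
  assumes "abelian_group M" and carrier: "carrier F = I \<rightarrow>\<^sub>E carrier M"
    and zero: "\<zero>\<^bsub>F\<^esub> = (\<lambda>i \<in> I. \<zero>)"
    and add: "add F = (\<lambda>f g. \<lambda>i \<in> I. f i \<oplus> g i)"
  shows "abelian_group F"
proof -
  interpret M: abelian_group M by fact
  note ext = PiE_ext[where k = I and s = "\<lambda>_. carrier M"]
  show ?thesis
  proof (rule abelian_groupI)
    fix f assume f: "f \<in> carrier F"
    show "\<exists>g \<in> carrier F. g \<oplus>\<^bsub>F\<^esub> f = \<zero>\<^bsub>F\<^esub>"
    proof
      show "(\<lambda>i \<in> I. \<ominus> f i) \<in> carrier F" using f by (auto simp: carrier)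
      show "(\<lambda>i \<in> I. \<ominus> f i) \<oplus>\<^bsub>F\<^esub> f = \<zero>\<^bsub>F\<^esub>"
        using f by (auto simp: carrier zero add M.l_neg PiE_const_mem intro!: restrict_ext)
    qed
    show "\<zero>\<^bsub>F\<^esub> \<oplus>\<^bsub>F\<^esub> f = f"
      using f by (intro ext[of _ f]) (auto simp: carrier zero add PiE_const_mem)
  qed (auto simp: carrier zero add M.a_assoc PiE_const_mem intro!: restrict_ext M.a_comm)
qed

context finite_type_comm_monoid
begin

lemma smult_conv_closed:
  assumes "module R M" and "\<alpha> \<in> carrier (conv_ring \<Gamma> R)" and "f \<in> carrier (conv_module \<Gamma> M)"
  shows "\<alpha> \<odot>\<^bsub>conv_module \<Gamma> M\<^esub> f \<in> carrier (conv_module \<Gamma> M)"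
proof -
  interpret module R M by fact
  show ?thesis
    using assms(2,3)
    by (auto simp: conv_ring_def conv_module_def PiE_const_mem factorizations_def intro!: M.finsum_closed)
qed

lemma smult_conv_l_distr:
  assumes "module R M" and "\<alpha> \<in> carrier (conv_ring \<Gamma> R)" and "\<beta> \<in> carrier (conv_ring \<Gamma> R)"
    and "f \<in> carrier (conv_module \<Gamma> M)"
  shows "(\<alpha> \<oplus>\<^bsub>conv_ring \<Gamma> R\<^esub> \<beta>) \<odot>\<^bsub>conv_module \<Gamma> M\<^esub> f
       = \<alpha> \<odot>\<^bsub>conv_module \<Gamma> M\<^esub> f \<oplus>\<^bsub>conv_module \<Gamma> M\<^esub> \<beta> \<odot>\<^bsub>conv_module \<Gamma> M\<^esub> f"
proof -
  interpret module R M by fact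
  note fun_mem = assms(2-4)[unfolded conv_ring_def conv_module_def, simplified, THEN PiE_mem]
  \<comment> \<open>The conditional is the restriction of the pointwise sum to the carrier, unfolded.\<close>
  have "finsum M (\<lambda>(a, b). (if a \<in> carrier \<Gamma> then \<alpha> a \<oplus>\<^bsub>R\<^esub> \<beta> a else undefined) \<odot>\<^bsub>M\<^esub> f b) (factorizations \<Gamma> n)
      = finsum M (\<lambda>(a, b). \<alpha> a \<odot>\<^bsub>M\<^esub> f b) (factorizations \<Gamma> n)
        \<oplus>\<^bsub>M\<^esub> finsum M (\<lambda>(a, b). \<beta> a \<odot>\<^bsub>M\<^esub> f b) (factorizations \<Gamma> n)" for n
    by (subst M.finsum_addf[symmetric])
      (auto simp: factorizations_def fun_mem smult_l_distr intro!: M.finsum_cong')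
  then show ?thesis
    by (auto simp: conv_ring_def conv_module_def restrict_def)
qed

lemma smult_conv_r_distr:
  assumes "module R M" and "\<alpha> \<in> carrier (conv_ring \<Gamma> R)"
    and "f \<in> carrier (conv_module \<Gamma> M)" and "g \<in> carrier (conv_module \<Gamma> M)"
  shows "\<alpha> \<odot>\<^bsub>conv_module \<Gamma> M\<^esub> (f \<oplus>\<^bsub>conv_module \<Gamma> M\<^esub> g)
       = \<alpha> \<odot>\<^bsub>conv_module \<Gamma> M\<^esub> f \<oplus>\<^bsub>conv_module \<Gamma> M\<^esub> \<alpha> \<odot>\<^bsub>conv_module \<Gamma> M\<^esub> g"
proof -
  interpret module R M by fact
  note fun_mem = assms(2-4)[unfolded conv_ring_def conv_module_def, simplified, THEN PiE_mem]
  \<comment> \<open>Again the restriction is unfolded.\<close>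
  have "finsum M (\<lambda>(a, b). \<alpha> a \<odot>\<^bsub>M\<^esub> (if b \<in> carrier \<Gamma> then f b \<oplus>\<^bsub>M\<^esub> g b else undefined)) (factorizations \<Gamma> n)
      = finsum M (\<lambda>(a, b). \<alpha> a \<odot>\<^bsub>M\<^esub> f b) (factorizations \<Gamma> n)
        \<oplus>\<^bsub>M\<^esub> finsum M (\<lambda>(a, b). \<alpha> a \<odot>\<^bsub>M\<^esub> g b) (factorizations \<Gamma> n)" for n
    by (subst M.finsum_addf[symmetric])
      (auto simp: factorizations_def fun_mem smult_r_distr intro!: M.finsum_cong')
  then show ?thesis
    by (auto simp: conv_ring_def conv_module_def restrict_def)
qed

lemma smult_conv_one:
  assumes "module R M" and "f \<in> carrier (conv_module \<Gamma> M)"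
  shows "\<one>\<^bsub>conv_ring \<Gamma> R\<^esub> \<odot>\<^bsub>conv_module \<Gamma> M\<^esub> f = f"
proof -
  interpret module R M by fact
  note fun_mem = assms(2)[unfolded conv_module_def, simplified, THEN PiE_mem]
  let ?e = "\<one>\<^bsub>conv_ring \<Gamma> R\<^esub>"
  have e: "?e a = (if a = \<one> then \<one>\<^bsub>R\<^esub> else \<zero>\<^bsub>R\<^esub>)" if "a \<in> carrier \<Gamma>" for a
    using that by (simp add: conv_ring_def)
  have "finsum M (\<lambda>(a, b). ?e a \<odot>\<^bsub>M\<^esub> f b) (factorizations \<Gamma> n) = f n" if n: "n \<in> carrier \<Gamma>" for n
  proof -
    \<comment> \<open>A factorization with first factor \<open>1\<close> is \<open>(1, n)\<close>; all the others contribute zero.\<close>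
    have "finsum M (\<lambda>(a, b). ?e a \<odot>\<^bsub>M\<^esub> f b) (factorizations \<Gamma> n)
        = finsum M (\<lambda>(a, b). ?e a \<odot>\<^bsub>M\<^esub> f b) {(\<one>, n)}"
      using n by (intro M.add.finprod_mono_neutral_cong_right finite_factorizations)
        (auto simp: factorizations_def e fun_mem split: if_splits)
    also have "\<dots> = f n" using n by (simp add: e fun_mem)
    finally show ?thesis .
  qed
  then show ?thesis
    using assms(2) unfolding conv_module_def
    by (intro PiE_ext[where k = "carrier \<Gamma>" and y = f]) (auto simp: fun_mem)
qed

lemma smult_conv_assoc:
  assumes "module R M" and "\<alpha> \<in> carrier (conv_ring \<Gamma> R)" and "\<beta> \<in> carrier (conv_ring \<Gamma> R)"
    and "f \<in> carrier (conv_module \<Gamma> M)"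
  shows "(\<alpha> \<otimes>\<^bsub>conv_ring \<Gamma> R\<^esub> \<beta>) \<odot>\<^bsub>conv_module \<Gamma> M\<^esub> f
       = \<alpha> \<odot>\<^bsub>conv_module \<Gamma> M\<^esub> (\<beta> \<odot>\<^bsub>conv_module \<Gamma> M\<^esub> f)"
proof -
  interpret module R M by fact
  let ?F = "factorizations \<Gamma>"
  let ?g = "\<lambda>a b c. \<alpha> a \<odot>\<^bsub>M\<^esub> (\<beta> b \<odot>\<^bsub>M\<^esub> f c)"
  note fun_mem = assms(2-4)[unfolded conv_ring_def conv_module_def, simplified, THEN PiE_mem]
  have l: "(\<alpha> \<otimes>\<^bsub>conv_ring \<Gamma> R\<^esub> \<beta>) d \<odot>\<^bsub>M\<^esub> f c = finsum M (\<lambda>(a, b). ?g a b c) (?F d)"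
    if "d \<in> carrier \<Gamma>" "c \<in> carrier \<Gamma>" for d c
  proof -
    have "(\<alpha> \<otimes>\<^bsub>conv_ring \<Gamma> R\<^esub> \<beta>) d \<odot>\<^bsub>M\<^esub> f c
        = finsum R (\<lambda>(a, b). \<alpha> a \<otimes>\<^bsub>R\<^esub> \<beta> b) (?F d) \<odot>\<^bsub>M\<^esub> f c"
      using that by (simp add: conv_ring_def)
    also have "\<dots> = finsum M (\<lambda>p. (case p of (a, b) \<Rightarrow> \<alpha> a \<otimes>\<^bsub>R\<^esub> \<beta> b) \<odot>\<^bsub>M\<^esub> f c) (?F d)"
      using that by (intro finsum_smult_rdistr finite_factorizations)
        (auto simp: factorizations_def fun_mem)
    also have "\<dots> = finsum M (\<lambda>(a, b). ?g a b c) (?F d)"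
      using that by (intro M.finsum_cong') (auto simp: factorizations_def fun_mem smult_assoc1)
    finally show ?thesis .
  qed
  have r: "\<alpha> a \<odot>\<^bsub>M\<^esub> (\<beta> \<odot>\<^bsub>conv_module \<Gamma> M\<^esub> f) d = finsum M (\<lambda>(b, c). ?g a b c) (?F d)"
    if "a \<in> carrier \<Gamma>" "d \<in> carrier \<Gamma>" for a d
  proof -
    have "\<alpha> a \<odot>\<^bsub>M\<^esub> (\<beta> \<odot>\<^bsub>conv_module \<Gamma> M\<^esub> f) d
        = \<alpha> a \<odot>\<^bsub>M\<^esub> finsum M (\<lambda>(b, c). \<beta> b \<odot>\<^bsub>M\<^esub> f c) (?F d)"
      using that by (simp add: conv_module_def)
    also have "\<dots> = finsum M (\<lambda>p. \<alpha> a \<odot>\<^bsub>M\<^esub> (case p of (b, c) \<Rightarrow> \<beta> b \<odot>\<^bsub>M\<^esub> f c)) (?F d)"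
      using that by (intro finsum_smult_ldistr finite_factorizations)
        (auto simp: factorizations_def fun_mem)
    also have "\<dots> = finsum M (\<lambda>(b, c). ?g a b c) (?F d)"
      using that by (intro M.finsum_cong') (auto simp: factorizations_def fun_mem)
    finally show ?thesis .
  qed
  have "finsum M (\<lambda>(d, c). (\<alpha> \<otimes>\<^bsub>conv_ring \<Gamma> R\<^esub> \<beta>) d \<odot>\<^bsub>M\<^esub> f c) (?F n)
      = finsum M (\<lambda>(a, d). \<alpha> a \<odot>\<^bsub>M\<^esub> (\<beta> \<odot>\<^bsub>conv_module \<Gamma> M\<^esub> f) d) (?F n)" if "n \<in> carrier \<Gamma>" for n
  proof -
    have "finsum M (\<lambda>(d, c). (\<alpha> \<otimes>\<^bsub>conv_ring \<Gamma> R\<^esub> \<beta>) d \<odot>\<^bsub>M\<^esub> f c) (?F n)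
        = finsum M (\<lambda>(d, c). finsum M (\<lambda>(a, b). ?g a b c) (?F d)) (?F n)"
      by (intro M.finsum_cong')
        (auto simp: l factorizations_closed fun_mem intro!: M.finsum_closed)
    also have "\<dots> = finsum M (\<lambda>(a, d). finsum M (\<lambda>(b, c). ?g a b c) (?F d)) (?F n)"
      using that by (intro finsum_factorizations_assoc M.abelian_monoid_axioms) (auto simp: fun_mem)
    also have "\<dots> = finsum M (\<lambda>(a, d). \<alpha> a \<odot>\<^bsub>M\<^esub> (\<beta> \<odot>\<^bsub>conv_module \<Gamma> M\<^esub> f) d) (?F n)"
    proof (intro M.finsum_cong')
      have mem: "finsum M (\<lambda>(b, c). ?g a b c) (?F d) \<in> carrier M" if "a \<in> carrier \<Gamma>" for a d
        using that by (intro M.finsum_closed) (auto simp: factorizations_closed fun_mem)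
      show "(\<lambda>(a, d). \<alpha> a \<odot>\<^bsub>M\<^esub> (\<beta> \<odot>\<^bsub>conv_module \<Gamma> M\<^esub> f) d) \<in> ?F n \<rightarrow> carrier M"
        by (auto simp: r mem factorizations_closed)
    qed (auto simp: r factorizations_closed)
    finally show ?thesis .
  qed
  then show ?thesis
    unfolding conv_module_def by (auto intro!: restrict_ext)
qed

end

text \<open>
  The ring \<open>R\<close> as a module over itself. The module axioms do not mention the fields \<^term>\<open>mult\<close>
  and \<^term>\<open>one\<close>; they are those of \<open>R\<close>.
\<close>

definition regular_module :: "('r, 'q) ring_scheme \<Rightarrow> ('r, 'r) module" where
  "regular_module R =
     \<lparr> carrier = carrier R, mult = mult R, one = \<one>\<^bsub>R\<^esub>, zero = \<zero>\<^bsub>R\<^esub>, add = add R, smult = mult R \<rparr>"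

lemma module_regular_module:
  assumes "cring R"
  shows "module R (regular_module R)"
proof -
  interpret cring R by fact
  have "abelian_group (regular_module R)"
    by (rule abelian_groupI) (auto simp: regular_module_def a_ac intro: add.l_inv_ex)
  then show ?thesis
    by (intro moduleI cring_axioms) (auto simp: regular_module_def l_distr r_distr m_assoc)
qed

text \<open>
  The two records have different types, so this equality is not an instance of reflexivity: it
  holds because finite sums depend only on the carrier, the zero and the addition.
\<close>

lemma finsum_regular_module: "finsum (regular_module R) = finsum R"
  by (intro ext) (simp add: finsum_def finprod_def regular_module_def)

text \<open>
  The convolution product of two scalar functions is the action of the first on the second
  viewed as an element of the convolution module of the regular module.
\<close>

lemma conv_module_regular_module:
  shows "carrier (conv_module \<Gamma> (regular_module R)) = carrier (conv_ring \<Gamma> R)"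
    and "add (conv_module \<Gamma> (regular_module R)) = add (conv_ring \<Gamma> R)"
    and "smult (conv_module \<Gamma> (regular_module R)) = mult (conv_ring \<Gamma> R)"
  unfolding conv_module_def finsum_regular_module
  by (simp_all add: conv_ring_def regular_module_def)

context finite_type_comm_monoid
begin

lemma conv_ring_commute:
  assumes "cring R" and "\<alpha> \<in> carrier (conv_ring \<Gamma> R)" and "\<beta> \<in> carrier (conv_ring \<Gamma> R)"
  shows "\<alpha> \<otimes>\<^bsub>conv_ring \<Gamma> R\<^esub> \<beta> = \<beta> \<otimes>\<^bsub>conv_ring \<Gamma> R\<^esub> \<alpha>"
proof -
  interpret R: cring R by fact
  note fun_mem = assms(2,3)[unfolded conv_ring_def, simplified, THEN PiE_mem]
  have "finsum R (\<lambda>(a, b). \<alpha> a \<otimes>\<^bsub>R\<^esub> \<beta> b) (factorizations \<Gamma> n)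
      = finsum R (\<lambda>(a, b). \<beta> a \<otimes>\<^bsub>R\<^esub> \<alpha> b) (factorizations \<Gamma> n)" for n
  proof -
    have "finsum R (\<lambda>(a, b). \<alpha> a \<otimes>\<^bsub>R\<^esub> \<beta> b) (factorizations \<Gamma> n)
        = finsum R (\<lambda>(a, b). \<alpha> b \<otimes>\<^bsub>R\<^esub> \<beta> a) (factorizations \<Gamma> n)"
      by (intro finsum_factorizations_commute R.abelian_monoid_axioms) (simp add: fun_mem)
    also have "\<dots> = finsum R (\<lambda>(a, b). \<beta> a \<otimes>\<^bsub>R\<^esub> \<alpha> b) (factorizations \<Gamma> n)"
      by (intro R.finsum_cong') (auto simp: factorizations_def fun_mem R.m_comm)
    finally show ?thesis .
  qed
  then show ?thesis by (simp add: conv_ring_def)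
qed

text \<open>
  All the axioms involving the product except commutativity are those of the convolution module
  of the regular module.
\<close>

lemma cring_conv_ring:
  assumes "cring R"
  shows "cring (conv_ring \<Gamma> R)"
proof -
  interpret R: cring R by fact
  note mod = module_regular_module[OF assms]
  note closed = smult_conv_closed[OF mod, unfolded conv_module_regular_module]
  note one = smult_conv_one[OF mod, unfolded conv_module_regular_module]
  note assoc = smult_conv_assoc[OF mod, unfolded conv_module_regular_module]
  note l_distr = smult_conv_l_distr[OF mod, unfolded conv_module_regular_module]
  show ?thesis
  proof (rule cringI)
    show "abelian_group (conv_ring \<Gamma> R)"
      by (rule abelian_group_PiE[OF R.abelian_group_axioms]) (simp_all add: conv_ring_def)
    show "comm_monoid (conv_ring \<Gamma> R)"
    proof (rule comm_monoidI)
      show "\<one>\<^bsub>conv_ring \<Gamma> R\<^esub> \<in> carrier (conv_ring \<Gamma> R)" by (auto simp: conv_ring_def)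
    qed (use closed one assoc conv_ring_commute[OF assms] in auto)
  qed (rule l_distr)
qed

proposition module_conv_module:
  assumes "module R M"
  shows "module (conv_ring \<Gamma> R) (conv_module \<Gamma> M)"
proof (rule moduleI)
  interpret module R M by fact
  show "cring (conv_ring \<Gamma> R)" by (rule cring_conv_ring) (rule R.cring_axioms)
  show "abelian_group (conv_module \<Gamma> M)"
    by (rule abelian_group_PiE[OF M.abelian_group_axioms]) (simp_all add: conv_module_def)
qed (fact smult_conv_closed[OF assms] smult_conv_l_distr[OF assms] smult_conv_r_distr[OF assms]
    smult_conv_assoc[OF assms] smult_conv_one[OF assms])+

end

section \<open>The functor and its exactness\<close>

lemma module_fun_module:
  assumes "module R M"
  shows "module R (fun_module \<Gamma> M)"
proof -
  interpret module R M by fact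
  note ext = PiE_ext[where k = "carrier \<Gamma>" and s = "\<lambda>_. carrier M"]
  have "abelian_group (fun_module \<Gamma> M)"
    by (rule abelian_group_PiE[OF M.abelian_group_axioms]) (simp_all add: fun_module_def)
  then show ?thesis
  proof (rule moduleI[OF R.cring_axioms])
    show "\<one>\<^bsub>R\<^esub> \<odot>\<^bsub>fun_module \<Gamma> M\<^esub> f = f" if "f \<in> carrier (fun_module \<Gamma> M)" for f
      using that by (intro ext[of _ f]) (auto simp: fun_module_def PiE_const_mem)
  qed (auto simp: fun_module_def PiE_const_mem smult_l_distr smult_r_distr smult_assoc1
      intro!: restrict_ext)
qed

lemma fun_module_map_mod_hom:
  assumes "module R M" and "\<phi> \<in> mod_hom R M N"
  shows "fun_module_map \<Gamma> M \<phi> \<in> mod_hom R (fun_module \<Gamma> M) (fun_module \<Gamma> N)"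
proof -
  interpret F: module R "fun_module \<Gamma> M" by (rule module_fun_module) fact
  have "fun_module_map \<Gamma> M \<phi> \<in> carrier (fun_module \<Gamma> M) \<rightarrow>\<^sub>E carrier (fun_module \<Gamma> N)"
    using assms(2) by (auto simp: fun_module_map_def fun_module_def mod_hom_def compose_def)
  moreover have "fun_module_map \<Gamma> M \<phi> (f \<oplus>\<^bsub>fun_module \<Gamma> M\<^esub> g)
      = fun_module_map \<Gamma> M \<phi> f \<oplus>\<^bsub>fun_module \<Gamma> N\<^esub> fun_module_map \<Gamma> M \<phi> g"
    if "f \<in> carrier (fun_module \<Gamma> M)" "g \<in> carrier (fun_module \<Gamma> M)" for f g
    using that F.M.a_closed[OF that] assms(2)
    by (auto simp: fun_module_map_def fun_module_def mod_hom_def compose_def PiE_const_mem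
        intro!: restrict_ext)
  moreover have "fun_module_map \<Gamma> M \<phi> (r \<odot>\<^bsub>fun_module \<Gamma> M\<^esub> f)
      = r \<odot>\<^bsub>fun_module \<Gamma> N\<^esub> fun_module_map \<Gamma> M \<phi> f"
    if "r \<in> carrier R" "f \<in> carrier (fun_module \<Gamma> M)" for r f
    using that F.smult_closed[OF that] assms(2)
    by (auto simp: fun_module_map_def fun_module_def mod_hom_def compose_def PiE_const_mem
        intro!: restrict_ext)
  ultimately show ?thesis by (simp add: mod_hom_def)
qed

lemma fun_module_map_id:
  "fun_module_map \<Gamma> M (\<lambda>x \<in> carrier M. x) = (\<lambda>f \<in> carrier (fun_module \<Gamma> M). f)"
  unfolding fun_module_map_def
proof (rule restrict_ext)
  fix f assume "f \<in> carrier (fun_module \<Gamma> M)"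
  then show "compose (carrier \<Gamma>) (\<lambda>x \<in> carrier M. x) f = f"
    by (intro PiE_ext[where k = "carrier \<Gamma>" and s = "\<lambda>_. carrier M" and y = f])
      (auto simp: fun_module_def compose_def PiE_const_mem)
qed

lemma fun_module_map_compose:
  assumes "\<phi> \<in> carrier M \<rightarrow> carrier N"
  shows "fun_module_map \<Gamma> M (compose (carrier M) \<psi> \<phi>)
       = compose (carrier (fun_module \<Gamma> M)) (fun_module_map \<Gamma> N \<psi>) (fun_module_map \<Gamma> M \<phi>)"
  using assms
  by (fastforce simp: fun_module_map_def fun_module_def compose_def PiE_iff intro!: restrict_ext)

text \<open>
  Exactness rests on the fact that taking all functions on a fixed set commutes with images;
  a preimage of a function is chosen pointwise.
\<close>

lemma image_compose_PiE: "compose I \<phi> ` (I \<rightarrow>\<^sub>E A) = I \<rightarrow>\<^sub>E \<phi> ` A"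
proof (intro equalityI subsetI)
  fix g assume g: "g \<in> I \<rightarrow>\<^sub>E \<phi> ` A"
  then have "\<forall>i \<in> I. \<exists>a. a \<in> A \<and> g i = \<phi> a" by (auto simp: PiE_iff)
  then obtain f where f: "\<forall>i \<in> I. f i \<in> A \<and> g i = \<phi> (f i)" by metis
  have "g = compose I \<phi> (restrict f I)"
    using g f by (intro PiE_ext[OF g]) (auto simp: compose_def)
  moreover have "restrict f I \<in> I \<rightarrow>\<^sub>E A" using f by auto
  ultimately show "g \<in> compose I \<phi> ` (I \<rightarrow>\<^sub>E A)" by (rule image_eqI)
qed (auto simp: compose_def)

lemma inj_on_compose_PiE:
  assumes "inj_on \<phi> A"
  shows "inj_on (compose I \<phi>) (I \<rightarrow>\<^sub>E A)"
proof (rule inj_onI)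
  fix f g assume fg: "f \<in> I \<rightarrow>\<^sub>E A" "g \<in> I \<rightarrow>\<^sub>E A" and eq: "compose I \<phi> f = compose I \<phi> g"
  show "f = g"
  proof (rule PiE_ext[OF fg])
    fix i assume i: "i \<in> I"
    from fun_cong[OF eq, of i] i have "\<phi> (f i) = \<phi> (g i)" by (simp add: compose_eq)
    with assms show "f i = g i" using fg i by (auto dest: inj_onD)
  qed
qed

lemma fun_module_map_image:
  "fun_module_map \<Gamma> M \<phi> ` carrier (fun_module \<Gamma> M) = carrier \<Gamma> \<rightarrow>\<^sub>E \<phi> ` carrier M"
  by (simp add: fun_module_map_def fun_module_def image_restrict_eq image_compose_PiE)

lemma a_kernel_fun_module_map:
  "a_kernel (fun_module \<Gamma> N) (fun_module \<Gamma> P) (fun_module_map \<Gamma> N \<psi>)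
     = carrier \<Gamma> \<rightarrow>\<^sub>E a_kernel N P \<psi>"
proof -
  have "compose (carrier \<Gamma>) \<psi> f = (\<lambda>n \<in> carrier \<Gamma>. \<zero>\<^bsub>P\<^esub>)
      \<longleftrightarrow> (\<forall>n \<in> carrier \<Gamma>. \<psi> (f n) = \<zero>\<^bsub>P\<^esub>)" for f
    by (auto simp: compose_def fun_eq_iff restrict_def)
  then show ?thesis
    by (auto simp: a_kernel_def' fun_module_map_def fun_module_def PiE_iff extensional_def)
qed

lemma exact_at_fun_module:
  assumes "exact_at M \<phi> N \<psi> P"
  shows "exact_at (fun_module \<Gamma> M) (fun_module_map \<Gamma> M \<phi>)
           (fun_module \<Gamma> N) (fun_module_map \<Gamma> N \<psi>) (fun_module \<Gamma> P)"
  using assms by (simp add: exact_at_def fun_module_map_image a_kernel_fun_module_map)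

lemma short_exact_fun_module:
  assumes "short_exact M \<phi> N \<psi> P"
  shows "short_exact (fun_module \<Gamma> M) (fun_module_map \<Gamma> M \<phi>)
           (fun_module \<Gamma> N) (fun_module_map \<Gamma> N \<psi>) (fun_module \<Gamma> P)"
proof -
  have "inj_on (fun_module_map \<Gamma> M \<phi>) (carrier (fun_module \<Gamma> M))"
    using assms inj_on_compose_PiE
    by (auto simp: short_exact_def fun_module_map_def fun_module_def inj_on_restrict_eq)
  moreover have "fun_module_map \<Gamma> N \<psi> ` carrier (fun_module \<Gamma> N) = carrier (fun_module \<Gamma> P)"
    using assms by (simp add: short_exact_def fun_module_map_image) (simp add: fun_module_def)
  ultimately show ?thesis
    using assms by (simp add: short_exact_def exact_at_fun_module)
qed

theorem proposition1p3:
  fixes R :: "('r, 'q) ring_scheme" and \<Gamma> :: "('g, 'h) monoid_scheme"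
  assumes "cring R" and "comm_monoid \<Gamma>" and "finite_type \<Gamma>"
  shows
    \<comment> \<open>(1)\<close>
    "(\<forall>M :: ('r, 'm) module. module R M \<longrightarrow> module (conv_ring \<Gamma> R) (conv_module \<Gamma> M))
    \<and>
    \<comment> \<open>(2), action on objects and on morphisms\<close>
    (\<forall>M :: ('r, 'm) module. module R M \<longrightarrow> module R (fun_module \<Gamma> M)) \<and>
    (\<forall>(M :: ('r, 'm) module) (N :: ('r, 'n) module) \<phi>.
       module R M \<and> module R N \<and> \<phi> \<in> mod_hom R M N \<longrightarrow>
       fun_module_map \<Gamma> M \<phi> \<in> mod_hom R (fun_module \<Gamma> M) (fun_module \<Gamma> N))
    \<and>
    \<comment> \<open>(2), identities and composites\<close>
    (\<forall>M :: ('r, 'm) module. module R M \<longrightarrow>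
       fun_module_map \<Gamma> M (\<lambda>x \<in> carrier M. x) = (\<lambda>f \<in> carrier (fun_module \<Gamma> M). f)) \<and>
    (\<forall>(M :: ('r, 'm) module) (N :: ('r, 'n) module) (P :: ('r, 'p) module) \<phi> \<psi>.
       module R M \<and> module R N \<and> module R P \<and> \<phi> \<in> mod_hom R M N \<and> \<psi> \<in> mod_hom R N P \<longrightarrow>
       fun_module_map \<Gamma> M (compose (carrier M) \<psi> \<phi>) =
       compose (carrier (fun_module \<Gamma> M)) (fun_module_map \<Gamma> N \<psi>) (fun_module_map \<Gamma> M \<phi>))
    \<and>
    \<comment> \<open>(2), exactness\<close>
    (\<forall>(M :: ('r, 'm) module) (N :: ('r, 'n) module) (P :: ('r, 'p) module) \<phi> \<psi>.
       module R M \<and> module R N \<and> module R P \<and> \<phi> \<in> mod_hom R M N \<and> \<psi> \<in> mod_hom R N P \<longrightarrow>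
       (exact_at M \<phi> N \<psi> P \<longrightarrow>
          exact_at (fun_module \<Gamma> M) (fun_module_map \<Gamma> M \<phi>)
                   (fun_module \<Gamma> N) (fun_module_map \<Gamma> N \<psi>) (fun_module \<Gamma> P)) \<and>
       (short_exact M \<phi> N \<psi> P \<longrightarrow>
          short_exact (fun_module \<Gamma> M) (fun_module_map \<Gamma> M \<phi>)
                      (fun_module \<Gamma> N) (fun_module_map \<Gamma> N \<psi>) (fun_module \<Gamma> P)))"
proof -
  interpret finite_type_comm_monoid \<Gamma>
    using assms by (simp add: finite_type_comm_monoid_def finite_type_comm_monoid_axioms_def)
  have "\<phi> \<in> carrier M \<rightarrow> carrier N" if "\<phi> \<in> mod_hom R M N"
    for M :: "('r, 'm) module" and N :: "('r, 'n) module" and \<phi>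
    using that by (auto simp: mod_hom_def)
  then show ?thesis
    by (simp add: module_conv_module module_fun_module fun_module_map_mod_hom fun_module_map_id
        fun_module_map_compose exact_at_fun_module short_exact_fun_module)
qed

end
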